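(* For every $d\ge 2$, the $5\times\cdots\times 5$ knight's framework in $\mathbb{R}^d$ is an infinitesimally rigid bipartite unit-bar framework.
   Context: A framework in $\mathbb{R}^d$ is a finite graph whose vertices (joints) are distinct points of $\mathbb{R}^d$ and whose edges (bars) are segments between pairs of joints. It is a unit-bar framework if all bars have the same length, and bipartite if its underlying graph is bipartite. An infinitesimal motion of $\mathbb{R}^d$ is a map $f:\mathbb{R}^d\to\mathbb{R}^d$ with $(f(x)-f(y))\cdot(x-y)=0$ for all $x,y$. For a framework $F$ with joint set $X$, an infinitesimal motion of $F$ is a map $g:X\to\mathbb{R}^d$ with $(g(x)-g(y))\cdot(x-y)=0$ for every bar $xy$; $F$ is infinitesimally rigid if every infinitesimal motion of $F$ is the restriction to $X$ of an infinitesimal motion of $\mathbb{R}^d$. The $n\times\cdots\times n$ knight's framework in $\mathbb{R}^d$ has as joints all points $(x_1,\ldots,x_d)$ with each $x_i\in\{0,\ldots,n-1\}$, and a bar between joints $x$ and $y$ exactly when their coordinates agree in all but two positions, and in those two positions they differ (in absolute value) by $1$ and by $2$ respectively. *)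

theory Defs
  imports "HOL-Analysis.Analysis"
begin

text \<open>A framework in R^d (d = CARD('n)) is given by its set of joints and its set of
  bars; a bar is recorded as an ordered pair of joints (x, y) (the set of bars is
  symmetric for the frameworks considered below).\<close>

type_synonym 'n framework = "(real^'n) set \<times> ((real^'n) \<times> (real^'n)) set"

definition joints :: "'n framework \<Rightarrow> (real^'n) set" where
  "joints F = fst F"

definition bars :: "'n framework \<Rightarrow> ((real^'n) \<times> (real^'n)) set" where
  "bars F = snd F"

definition is_framework :: "('n::finite) framework \<Rightarrow> bool" where
  "is_framework F \<longleftrightarrow> finite (joints F) \<and>
     (\<forall>(x,y)\<in>bars F. x \<in> joints F \<and> y \<in> joints F \<and> x \<noteq> y)"

definition unit_bar :: "('n::finite) framework \<Rightarrow> bool" where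
  "unit_bar F \<longleftrightarrow> (\<exists>L. \<forall>(x,y)\<in>bars F. dist x y = L)"

definition bipartite_fw :: "('n::finite) framework \<Rightarrow> bool" where
  "bipartite_fw F \<longleftrightarrow> (\<exists>A. \<forall>(x,y)\<in>bars F. (x \<in> A \<longleftrightarrow> y \<notin> A))"

definition inf_motion_space :: "(real^'n \<Rightarrow> real^'n) \<Rightarrow> bool" where
  "inf_motion_space f \<longleftrightarrow> (\<forall>x y. (f x - f y) \<bullet> (x - y) = 0)"

definition inf_motion_fw :: "('n::finite) framework \<Rightarrow> (real^'n \<Rightarrow> real^'n) \<Rightarrow> bool" where
  "inf_motion_fw F g \<longleftrightarrow> (\<forall>(x,y)\<in>bars F. (g x - g y) \<bullet> (x - y) = 0)"

text \<open>Motions of F are maps on the joints; we represent them by total maps whose values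
  off the joints are irrelevant.\<close>
definition inf_rigid :: "('n::finite) framework \<Rightarrow> bool" where
  "inf_rigid F \<longleftrightarrow> (\<forall>g. inf_motion_fw F g \<longrightarrow>
      (\<exists>f. inf_motion_space f \<and> (\<forall>x\<in>joints F. g x = f x)))"

definition knight_framework :: "nat \<Rightarrow> ('n::finite) framework" where
  "knight_framework n =
    (let J = {x :: real^'n. \<forall>i. x $ i \<in> real ` {0..<n}} in
     (J, {(x,y). x \<in> J \<and> y \<in> J \<and>
          (\<exists>i j. i \<noteq> j \<and> \<bar>x $ i - y $ i\<bar> = 1 \<and> \<bar>x $ j - y $ j\<bar> = 2 \<and>
                 (\<forall>k. k \<noteq> i \<and> k \<noteq> j \<longrightarrow> x $ k = y $ k))}))"

end

theory Submission
  imports Defs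
begin

text \<open>In the plane, a motion moves the far end of a bar relative to the near end by a scalar
  (the spin of the bar) times the bar vector turned by a right angle. The four sides of a rhombus
  close up, so opposite sides have equal spins, and on the \<open>5 \<times> 5\<close> board rhombi connect any two
  parallel bars. This leaves one spin per bar direction; two closed walks show that the four
  spins agree. Subtracting the corresponding rotation leaves a map that is constant along knight moves.

  In higher dimension, the planar case applied to coordinate plane sections shows that the \<open>i\<close>-th
  component of a motion does not depend on \<open>x\<^sub>i\<close>, is affine in each \<open>x\<^sub>j\<close>, and that its slope
  in \<open>x\<^sub>j\<close> is minus the slope of the \<open>j\<close>-th component in \<open>x\<^sub>i\<close>. The mixed second differences of the
  components therefore form a tensor symmetric in two indices and antisymmetric in another two,
  which vanishes; so the slopes are constant and form an antisymmetric matrix.\<close>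

section \<open>Connectivity of the 5 x 5 knight's graph\<close>

lemma less_numeral_cases:
  "(n::nat) < 3 \<longleftrightarrow> n = 0 \<or> n = 1 \<or> n = 2"
  "n < 4 \<longleftrightarrow> n = 0 \<or> n = 1 \<or> n = 2 \<or> n = 3"
  "n < 5 \<longleftrightarrow> n = 0 \<or> n = 1 \<or> n = 2 \<or> n = 3 \<or> n = 4"
  by auto

text \<open>The 24 instances supplied are the edges of a spanning tree of the 25 squares, rooted at
  (0,0).\<close>

lemma knight_connected:
  fixes f :: "nat \<Rightarrow> nat \<Rightarrow> 'a"
  assumes move: "\<And>a b. \<lbrakk>a < 4; b < 3\<rbrakk> \<Longrightarrow> f (a+1) (b+2) = f a b"
    "\<And>a b. \<lbrakk>a < 4; b < 3\<rbrakk> \<Longrightarrow> f (a+1) b = f a (b+2)"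
    "\<And>a b. \<lbrakk>a < 3; b < 4\<rbrakk> \<Longrightarrow> f (a+2) (b+1) = f a b"
    "\<And>a b. \<lbrakk>a < 3; b < 4\<rbrakk> \<Longrightarrow> f (a+2) b = f a (b+1)"
    and "a < 5" "b < 5"
  shows "f a b = f 0 0"
  using assms(5,6)[unfolded less_numeral_cases] move(1)[of 0 0]
    move(3)[of 0 0]
    move(1)[of 1 2]
    move(2)[of 1 0]
    move(2)[of 0 2]
    move(3)[of 1 2]
    move(4)[of 1 1]
    move(2)[of 1 1]
    move(3)[of 2 1]
    move(4)[of 2 0]
    move(4)[of 0 1]
    move(2)[of 2 2]
    move(3)[of 0 3]
    move(4)[of 2 3]
    move(3)[of 2 0]
    move(4)[of 0 0]
    move(4)[of 0 3]
    move(4)[of 1 3]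
    move(3)[of 1 0]
    move(3)[of 1 3]
    move(1)[of 3 0]
    move(1)[of 3 2]
    move(3)[of 1 1]
    move(4)[of 0 2]
  by (auto simp: eval_nat_numeral)

section \<open>Planar rigidity on the 5 x 5 board\<close>

locale knight_motion =
  fixes u v :: "nat \<Rightarrow> nat \<Rightarrow> real"
  assumes ortho: "\<lbrakk>a < 5; b < 5; c < 5; d < 5;
      \<bar>real a - real c\<bar> = 1 \<and> \<bar>real b - real d\<bar> = 2 \<or>
      \<bar>real a - real c\<bar> = 2 \<and> \<bar>real b - real d\<bar> = 1\<rbrakk> \<Longrightarrow>
    (u a b - u c d) * (real a - real c) + (v a b - v c d) * (real b - real d) = 0"
begin

text \<open>The spins of the bars with directions (1,2), (1,-2), (2,1), (2,-1); the indices are those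
  of the lower left corner of the bounding box of the bar.\<close>

definition spin12 where "spin12 a b = v (a+1) (b+2) - v a b"
definition spin12' where "spin12' a b = v (a+1) b - v a (b+2)"
definition spin21 where "spin21 a b = u a b - u (a+2) (b+1)"
definition spin21' where "spin21' a b = u (a+2) b - u a (b+1)"

lemmas spin_defs = spin12_def spin12'_def spin21_def spin21'_def

text \<open>The bar (1,2) turned by a right angle is (-2,1), and likewise for the other directions.
  So each spin is, up to sign, one component of the relative motion, and orthogonality to the bar
  gives the other component.\<close>

lemma bar_equations:
  "a < 4 \<Longrightarrow> b < 3 \<Longrightarrow> u (a+1) (b+2) - u a b = - 2 * spin12 a b"
  "a < 4 \<Longrightarrow> b < 3 \<Longrightarrow> u (a+1) b - u a (b+2) = 2 * spin12' a b"
  "a < 3 \<Longrightarrow> b < 4 \<Longrightarrow> v (a+2) (b+1) - v a b = 2 * spin21 a b"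
  "a < 3 \<Longrightarrow> b < 4 \<Longrightarrow> v (a+2) b - v a (b+1) = 2 * spin21' a b"
  using ortho[of "a+1" "b+2" a b] ortho[of "a+1" b a "b+2"]
    ortho[of "a+2" "b+1" a b] ortho[of "a+2" b a "b+1"]
  unfolding spin_defs by simp_all

text \<open>One clause for each pair among the four directions. Closing up forces a linear relation
  between the two side vectors, which are independent, so both spin differences vanish. The bounds
  keep the rhombus on the board.\<close>

lemma rhombus:
  "a < 2 \<Longrightarrow> b < 2 \<Longrightarrow> spin12 (a+2) (b+1) = spin12 a b \<and> spin21 (a+1) (b+2) = spin21 a b"
  "a < 2 \<Longrightarrow> b < 2 \<Longrightarrow> spin12 (a+2) b = spin12 a (b+1) \<and> spin21' (a+1) (b+2) = spin21' a b"
  "a < 2 \<Longrightarrow> b < 2 \<Longrightarrow> spin12' (a+2) (b+1) = spin12' a b \<and> spin21 (a+1) b = spin21 a (b+2)"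
  "a < 2 \<Longrightarrow> b < 2 \<Longrightarrow> spin12' (a+2) b = spin12' a (b+1) \<and> spin21' (a+1) b = spin21' a (b+2)"
  "a < 3 \<Longrightarrow> b < 1 \<Longrightarrow> spin12 (a+1) b = spin12 a (b+2) \<and> spin12' (a+1) (b+2) = spin12' a b"
  "a < 1 \<Longrightarrow> b < 3 \<Longrightarrow> spin21 (a+2) b = spin21 a (b+1) \<and> spin21' (a+2) (b+1) = spin21' a b"
  apply -
  subgoal
    using bar_equations(1)[of a b]
      bar_equations(1)[of "a+2" "b+1"]
      bar_equations(3)[of a b]
      bar_equations(3)[of "a+1" "b+2"]
    by (simp add: spin_defs add.assoc)
  subgoal
    using bar_equations(1)[of a "b+1"]
      bar_equations(1)[of "a+2" b]
      bar_equations(4)[of a b]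
      bar_equations(4)[of "a+1" "b+2"]
    by (simp add: spin_defs add.assoc)
  subgoal
    using bar_equations(2)[of a b]
      bar_equations(2)[of "a+2" "b+1"]
      bar_equations(3)[of a "b+2"]
      bar_equations(3)[of "a+1" b]
    by (simp add: spin_defs add.assoc)
  subgoal
    using bar_equations(2)[of a "b+1"]
      bar_equations(2)[of "a+2" b]
      bar_equations(4)[of a "b+2"]
      bar_equations(4)[of "a+1" b]
    by (simp add: spin_defs add.assoc)
  subgoal
    using bar_equations(1)[of a "b+2"]
      bar_equations(1)[of "a+1" b]
      bar_equations(2)[of a b]
      bar_equations(2)[of "a+1" "b+2"]
    by (simp add: spin_defs add.assoc)
  subgoal
    using bar_equations(3)[of a "b+1"]
      bar_equations(3)[of "a+2" b]
      bar_equations(4)[of a b]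
      bar_equations(4)[of "a+2" "b+1"]
    by (simp add: spin_defs add.assoc)
  done

text \<open>The eleven rhombi used link the twelve bars of this direction in a spanning tree. The
  other three directions work the same way.\<close>

lemma spin12_constant:
  assumes "a < 4" "b < 3"
  shows "spin12 a b = spin12 0 0"
  using assms[unfolded less_numeral_cases] rhombus(1)[of 0 0]
    rhombus(2)[of 0 1]
    rhombus(5)[of 0 0]
    rhombus(1)[of 1 0]
    rhombus(2)[of 1 1]
    rhombus(5)[of 1 0]
    rhombus(2)[of 0 0]
    rhombus(1)[of 0 1]
    rhombus(5)[of 2 0]
    rhombus(2)[of 1 0]
    rhombus(1)[of 1 1]
  by (auto simp: eval_nat_numeral)

lemma spin12'_constant:
  assumes "a < 4" "b < 3"
  shows "spin12' a b = spin12' 0 0"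
  using assms[unfolded less_numeral_cases] rhombus(3)[of 0 0]
    rhombus(5)[of 0 0]
    rhombus(4)[of 0 1]
    rhombus(4)[of 1 1]
    rhombus(3)[of 1 0]
    rhombus(5)[of 1 0]
    rhombus(3)[of 0 1]
    rhombus(4)[of 0 0]
    rhombus(5)[of 2 0]
    rhombus(3)[of 1 1]
    rhombus(4)[of 1 0]
  by (auto simp: eval_nat_numeral)

lemma spin21_constant:
  assumes "a < 3" "b < 4"
  shows "spin21 a b = spin21 0 0"
  using assms[unfolded less_numeral_cases] rhombus(1)[of 0 0]
    rhombus(3)[of 1 0]
    rhombus(6)[of 0 0]
    rhombus(1)[of 0 1]
    rhombus(3)[of 1 1]
    rhombus(6)[of 0 1]
    rhombus(3)[of 0 0]
    rhombus(1)[of 1 0]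
    rhombus(6)[of 0 2]
    rhombus(3)[of 0 1]
    rhombus(1)[of 1 1]
  by (auto simp: eval_nat_numeral)

lemma spin21'_constant:
  assumes "a < 3" "b < 4"
  shows "spin21' a b = spin21' 0 0"
  using assms[unfolded less_numeral_cases] rhombus(2)[of 0 0]
    rhombus(6)[of 0 0]
    rhombus(4)[of 1 0]
    rhombus(4)[of 1 1]
    rhombus(2)[of 0 1]
    rhombus(6)[of 0 1]
    rhombus(2)[of 1 0]
    rhombus(4)[of 0 0]
    rhombus(6)[of 0 2]
    rhombus(2)[of 1 1]
    rhombus(4)[of 0 1]
  by (auto simp: eval_nat_numeral)

lemma increments:
  "a < 4 \<Longrightarrow> b < 3 \<Longrightarrow> u (a+1) (b+2) = u a b - 2 * spin12 0 0"
  "a < 4 \<Longrightarrow> b < 3 \<Longrightarrow> v (a+1) (b+2) = v a b + spin12 0 0"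
  "a < 4 \<Longrightarrow> b < 3 \<Longrightarrow> u (a+1) b = u a (b+2) + 2 * spin12' 0 0"
  "a < 4 \<Longrightarrow> b < 3 \<Longrightarrow> v (a+1) b = v a (b+2) + spin12' 0 0"
  "a < 3 \<Longrightarrow> b < 4 \<Longrightarrow> u (a+2) (b+1) = u a b - spin21 0 0"
  "a < 3 \<Longrightarrow> b < 4 \<Longrightarrow> v (a+2) (b+1) = v a b + 2 * spin21 0 0"
  "a < 3 \<Longrightarrow> b < 4 \<Longrightarrow> u (a+2) b = u a (b+1) + spin21' 0 0"
  "a < 3 \<Longrightarrow> b < 4 \<Longrightarrow> v (a+2) b = v a (b+1) + 2 * spin21' 0 0"
  using bar_equations[of a b] spin12_constant[of a b] spin12'_constant[of a b]
    spin21_constant[of a b] spin21'_constant[of a b]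
  by (simp_all add: spin_defs)

text \<open>The four spins are compared along two pairs of walks with common ends:
  \<open>(2,1) + (2,-1) = 2(1,2) + 2(1,-2)\<close> and \<open>(1,2) - (1,-2) = 2(2,1) - 2(2,-1)\<close>.\<close>

lemma spins_agree:
  "spin12' 0 0 = spin12 0 0" "spin21 0 0 = spin12 0 0" "spin21' 0 0 = spin12 0 0"
proof -
  note [simp] = eval_nat_numeral
  \<comment> \<open>Both walks of the first pair lead from (0,1) to (4,1). Comparing
    \<open>u\<close> gives this equation, comparing \<open>v\<close> the next one.\<close>
  have "spin21' 0 0 - spin21 0 0 = 4 * spin12' 0 0 - 4 * spin12 0 0"
    using increments(5)[of 0 1, simplified] increments(7)[of 2 1, simplified]
      increments(1)[of 0 1, simplified] increments(3)[of 1 1, simplified]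
      increments(1)[of 2 1, simplified] increments(3)[of 3 1, simplified]
    by linarith
  moreover have "2 * spin21 0 0 + 2 * spin21' 0 0 = 2 * spin12 0 0 + 2 * spin12' 0 0"
    using increments(6)[of 0 1, simplified] increments(8)[of 2 1, simplified]
      increments(2)[of 0 1, simplified] increments(4)[of 1 1, simplified]
      increments(2)[of 2 1, simplified] increments(4)[of 3 1, simplified]
    by linarith
  \<comment> \<open>The second pair of walks leads from (1,0) to (1,4); here \<open>v\<close> is
    compared.\<close>
  moreover have "spin12 0 0 - spin12' 0 0 = 4 * spin21 0 0 - 4 * spin21' 0 0"
    using increments(2)[of 1 0, simplified] increments(4)[of 1 2, simplified]
      increments(6)[of 1 0, simplified] increments(8)[of 1 1, simplified]
      increments(6)[of 1 2, simplified] increments(8)[of 1 3, simplified]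
    by linarith
  \<comment> \<open>With x = \<open>spin12 0 0 - spin12' 0 0\<close> and y =
    \<open>spin21 0 0 - spin21' 0 0\<close>, the first and third equations say y = 4x and x = 4y, so
    both vanish; the second then equates the two remaining values.\<close>
  ultimately show "spin12' 0 0 = spin12 0 0" "spin21 0 0 = spin12 0 0" "spin21' 0 0 = spin12 0 0"
    by linarith+
qed

lemma rigid_motion:
  assumes "a < 5" "b < 5"
  shows "u a b = u 0 0 - spin12 0 0 * real b" "v a b = v 0 0 + spin12 0 0 * real a"
proof -
  \<comment> \<open>The term with \<open>real 0\<close> is kept so that the equation has the shape
    \<open>f a b = f 0 0\<close>.\<close>
  have "u a b + spin12 0 0 * real b = u 0 0 + spin12 0 0 * real 0"
    by (rule knight_connected[of "\<lambda>a b. u a b + spin12 0 0 * real b"])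
      (use assms in \<open>simp_all only: increments spins_agree of_nat_add of_nat_numeral of_nat_1,
        simp_all add: algebra_simps\<close>)
  then show "u a b = u 0 0 - spin12 0 0 * real b"
    by simp
  have "v a b - spin12 0 0 * real a = v 0 0 - spin12 0 0 * real 0"
    by (rule knight_connected[of "\<lambda>a b. v a b - spin12 0 0 * real a"])
      (use assms in \<open>simp_all only: increments spins_agree of_nat_add of_nat_numeral of_nat_1,
        simp_all add: algebra_simps\<close>)
  then show "v a b = v 0 0 + spin12 0 0 * real a"
    by simp
qed

end

section \<open>From planar slices to affine maps in any dimension\<close>

text \<open>Switch the coordinates from 0 to their values in \<open>p\<close> one at a time;
  \<open>C k\<close> is the same at every base point, so the increments add up.\<close>

lemma coordinatewise_affine:
  fixes F :: "('n::finite \<Rightarrow> nat) \<Rightarrow> real"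
  assumes step: "\<And>p k c. \<lbrakk>\<And>i. p i < N; c < N\<rbrakk> \<Longrightarrow> F (p(k := c)) = F (p(k := 0)) + C k * real c"
    and p: "\<And>i. p i < N"
    and "0 < N"
  shows "F p = F (\<lambda>_. 0) + (\<Sum>k\<in>UNIV. C k * real (p k))"
proof -
  have "F (\<lambda>i. if i \<in> S then p i else 0) = F (\<lambda>_. 0) + (\<Sum>k\<in>S. C k * real (p k))"
    for S :: "'n set"
  proof (induction S rule: finite_induct[OF finite])
    case 1
    show ?case by simp
  next
    case (2 k S)
    let ?q = "\<lambda>i. if i \<in> S then p i else 0"
    have "(\<lambda>i. if i \<in> insert k S then p i else 0) = ?q(k := p k)" "?q(k := 0) = ?q"
      using 2 by auto
    then show ?case
      using step[of ?q "p k" k] 2 p \<open>0 < N\<close> by (auto simp: algebra_simps)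
  qed
  from this[of UNIV] show ?thesis by simp
qed

text \<open>\<open>h i p\<close> stands for the \<open>i\<close>-th velocity component at the grid
  point \<open>p\<close>. The rate \<open>w\<close> may depend on the slice; showing that it does
  not is the task here.\<close>

locale slicewise_rigid =
  fixes h :: "'n::finite \<Rightarrow> ('n \<Rightarrow> nat) \<Rightarrow> real" and N :: nat
  assumes slice: "\<lbrakk>i \<noteq> j; \<And>k. p k < N\<rbrakk> \<Longrightarrow> \<exists>w. \<forall>a<N. \<forall>b<N.
      h i (p(i := a, j := b)) = h i (p(i := 0, j := 0)) - w * real b \<and>
      h j (p(i := a, j := b)) = h j (p(i := 0, j := 0)) + w * real a"
    and N: "1 < N" and two_coordinates: "\<exists>j. j \<noteq> (i::'n)"
begin

definition slope where "slope i j p = h i (p(j := 1)) - h i (p(j := 0))"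

text \<open>In the slice spanned by \<open>i\<close> and any other \<open>j\<close>, component
  \<open>i\<close> varies with coordinate \<open>j\<close> only.\<close>

lemma own_coordinate:
  assumes "\<And>k. p k < N" "a < N"
  shows "h i (p(i := a)) = h i p"
proof -
  obtain j where j: "i \<noteq> j" using two_coordinates[of i] by metis
  obtain w where "\<And>a b. a < N \<Longrightarrow> b < N \<Longrightarrow>
      h i (p(i := a, j := b)) = h i (p(i := 0, j := 0)) - w * real b"
    using slice[OF j, of p] assms(1) by blast
  from this[of a "p j"] this[of "p i" "p j"] show ?thesis
    using assms j by (simp add: fun_upd_twist[OF j])
qed

lemma slope_same: "(\<And>k. p k < N) \<Longrightarrow> slope i i p = 0"
  using own_coordinate[of p 0 i] own_coordinate[of p 1 i] N by (simp add: slope_def)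

lemma affine:
  assumes "\<And>k. p k < N" "b < N"
  shows "h i (p(j := b)) = h i (p(j := 0)) + slope i j p * real b"
proof (cases "i = j")
  case True
  then show ?thesis
    using own_coordinate[of p b i] own_coordinate[of p 0 i] slope_same[of p i] assms N by simp
next
  case False
  obtain w where "\<And>a b. a < N \<Longrightarrow> b < N \<Longrightarrow>
      h i (p(i := a, j := b)) = h i (p(i := 0, j := 0)) - w * real b"
    using slice[OF False, of p] assms(1) by blast
  from this[of "p i" b] this[of "p i" 0] this[of "p i" 1] show ?thesis
    using assms N by (simp add: slope_def)
qed

text \<open>One rotation rate \<open>w\<close> governs both components in the slice: the slopes are
  \<open>- w\<close> and \<open>w\<close>.\<close>

lemma slope_antisym:
  assumes "\<And>k. p k < N"
  shows "slope i j p = - slope j i p"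
proof (cases "i = j")
  case True
  then show ?thesis using slope_same[of p i] assms by simp
next
  case False
  obtain w where w: "\<And>a b. a < N \<Longrightarrow> b < N \<Longrightarrow>
      h i (p(i := a, j := b)) = h i (p(i := 0, j := 0)) - w * real b \<and>
      h j (p(i := a, j := b)) = h j (p(i := 0, j := 0)) + w * real a"
    using slice[OF False, of p] assms(1) by blast
  have "p(i := a, j := p j) = p(i := a)" for a
    using False by auto
  with w[of "p i" 0] w[of "p i" 1] w[of 0 "p j"] w[of 1 "p j"] show ?thesis
    using assms N by (simp add: slope_def)
qed

text \<open>The mixed second difference of component \<open>i\<close> in coordinates
  \<open>j\<close> and \<open>k\<close>.\<close>

definition twist where "twist i j k p = slope i k (p(j := 1)) - slope i k (p(j := 0))"

lemma twist_sym: "j \<noteq> k \<Longrightarrow> twist i j k p = twist i k j p"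
  unfolding twist_def slope_def by (simp add: fun_upd_twist)

lemma twist_antisym: "(\<And>k. p k < N) \<Longrightarrow> twist i j k p = - twist k j i p"
  unfolding twist_def using slope_antisym[of "p(j := 1)" i k] slope_antisym[of "p(j := 0)" i k] N
  by simp

text \<open>Alternating the two index swaps three times each restores the order of the indices,
  while the three antisymmetric swaps reverse the sign.\<close>

lemma twist_zero:
  assumes "\<And>k. p k < N" "i \<noteq> j" "j \<noteq> k" "i \<noteq> k"
  shows "twist i j k p = 0"
proof -
  have "twist i j k p = twist i k j p" by (rule twist_sym) fact
  also have "\<dots> = - twist j k i p" by (rule twist_antisym) fact
  also have "\<dots> = - twist j i k p" using twist_sym[of k i j p] assms by simp
  also have "\<dots> = twist k i j p" using twist_antisym[of p j i k] assms by simp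
  also have "\<dots> = twist k j i p" by (rule twist_sym) fact
  also have "\<dots> = - twist i j k p" by (rule twist_antisym) fact
  finally show ?thesis by simp
qed

lemma slope_update:
  assumes p: "\<And>k. p k < N" and "c < N"
  shows "slope i j (p(k := c)) = slope i j (p(k := 0))"
proof -
  consider "i = j" | "k = j" | "i \<noteq> j" "k = i" | "i \<noteq> j" "k \<noteq> j" "k \<noteq> i" by metis
  then show ?thesis
  proof cases
    case 1
    then show ?thesis using slope_same[of "p(k := c)" i] slope_same[of "p(k := 0)" i] assms by simp
  next
    case 2
    then show ?thesis by (simp add: slope_def)
  next
    case 3
    have "h i (p(i := c, j := b)) = h i (p(i := 0, j := b))" if "b < N" for b
      using own_coordinate[of "p(j := b)" _ i] assms that 3
      by (simp add: fun_upd_twist)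
    then show ?thesis using N 3 by (simp add: slope_def)
  next
    case 4
    \<comment> \<open>Subtracting the case \<open>b = 0\<close> from \<open>b = 1\<close> shows that
      \<open>slope i j\<close> changes with \<open>c\<close> at rate
      \<open>twist i j k p\<close>.\<close>
    have *: "h i (p(k := c, j := b)) = h i (p(k := 0, j := b)) + slope i k (p(j := b)) * real c"
      if "b < N" for b
      using affine[of "p(j := b)" c i k] assms that 4 by (simp add: fun_upd_twist)
    have "slope i j (p(k := c)) = slope i j (p(k := 0)) + twist i j k p * real c"
      using *[of 0] *[of 1] N by (simp add: slope_def[of i j] twist_def algebra_simps)
    then show ?thesis using twist_zero[OF p, of i j k] 4 by simp
  qed
qed

lemma slope_const:
  assumes "\<And>k. p k < N"
  shows "slope i j p = slope i j (\<lambda>_. 0)"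
proof -
  \<comment> \<open>Constancy is the affine case with all coefficients 0.\<close>
  have "slope i j p = slope i j (\<lambda>_. 0) + (\<Sum>k\<in>UNIV. 0 * real (p k))"
  proof (rule coordinatewise_affine[of N])
    fix q :: "'n \<Rightarrow> nat" and k c
    assume "\<And>i. q i < N" "c < N"
    then show "slope i j (q(k := c)) = slope i j (q(k := 0)) + 0 * real c"
      using slope_update[of q c i j k] by simp
  qed (use assms N in auto)
  then show ?thesis by simp
qed

lemma globally_affine:
  assumes "\<And>k. p k < N"
  shows "h i p = h i (\<lambda>_. 0) + (\<Sum>j\<in>UNIV. slope i j (\<lambda>_. 0) * real (p j))"
proof (rule coordinatewise_affine[of N])
  fix q :: "'n \<Rightarrow> nat" and k c
  assume "\<And>i. q i < N" "c < N"
  then show "h i (q(k := c)) = h i (q(k := 0)) + slope i k (\<lambda>_. 0) * real c"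
    using affine[of q c i k] slope_const[of q i k] by simp
qed (use assms N in auto)

end

section \<open>Joints, bars, equal lengths and bipartiteness\<close>

definition grid_point :: "('n::finite \<Rightarrow> nat) \<Rightarrow> real^'n" where
  "grid_point p = (\<chi> i. real (p i))"

lemma grid_point_nth [simp]: "grid_point p $ i = real (p i)"
  by (simp add: grid_point_def)

lemma joints_knight: "joints (knight_framework n) = grid_point ` {p. \<forall>k. p k < n}"
proof -
  have "x \<in> grid_point ` {p. \<forall>k. p k < n}" if "\<forall>i. x $ i \<in> real ` {0..<n}" for x :: "real^'n"
  proof -
    from that obtain p where "\<forall>i. x $ i = real (p i) \<and> p i < n"
      unfolding image_iff by (metis atLeastLessThan_iff)
    then show ?thesis by (intro image_eqI[of _ _ p]) (auto simp: vec_eq_iff)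
  qed
  then show ?thesis
    by (auto simp: joints_def knight_framework_def Let_def)
qed

lemma finite_joints_knight: "finite (joints (knight_framework n :: 'n::finite framework))"
proof -
  have "{p :: 'n \<Rightarrow> nat. \<forall>k. p k < n} = PiE UNIV (\<lambda>_. {..<n})"
    by (auto simp: PiE_UNIV_domain)
  then show ?thesis
    by (simp add: joints_knight finite_PiE)
qed

lemma bars_knight:
  "(x, y) \<in> bars (knight_framework n) \<longleftrightarrow>
    x \<in> joints (knight_framework n) \<and> y \<in> joints (knight_framework n) \<and>
    (\<exists>i j. i \<noteq> j \<and> \<bar>x $ i - y $ i\<bar> = 1 \<and> \<bar>x $ j - y $ j\<bar> = 2 \<and>
      (\<forall>k. k \<noteq> i \<and> k \<noteq> j \<longrightarrow> x $ k = y $ k))"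
  by (simp add: bars_def joints_def knight_framework_def Let_def)

lemma sum_two_terms:
  fixes f :: "'n::finite \<Rightarrow> 'a::comm_monoid_add"
  assumes "i \<noteq> j" "\<And>k. k \<noteq> i \<Longrightarrow> k \<noteq> j \<Longrightarrow> f k = 0"
  shows "sum f UNIV = f i + f j"
  using assms sum.mono_neutral_right[of UNIV "{i, j}" f] by auto

lemma is_framework_knight: "is_framework (knight_framework n :: 'n::finite framework)"
  unfolding is_framework_def by (auto simp: finite_joints_knight bars_knight)

lemma unit_bar_knight: "unit_bar (knight_framework n :: 'n::finite framework)"
  unfolding unit_bar_def
proof (intro exI[of _ "sqrt 5"] ballI, clarify)
  fix x y :: "real^'n"
  assume "(x, y) \<in> bars (knight_framework n)"
  then obtain i j where ij: "i \<noteq> j" "\<bar>x $ i - y $ i\<bar> = 1" "\<bar>x $ j - y $ j\<bar> = 2"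
    "\<And>k. k \<noteq> i \<Longrightarrow> k \<noteq> j \<Longrightarrow> x $ k = y $ k"
    by (auto simp: bars_knight)
  then show "dist x y = sqrt 5"
    using sum_two_terms[of i j "\<lambda>k. (dist (x $ k) (y $ k))\<^sup>2"]
    by (simp add: dist_vec_def L2_set_def dist_real_def)
qed

text \<open>Colour by the parity of the coordinate sum, which a knight move changes by an odd
  amount. Floors turn the integral real coordinates of joints into integers.\<close>

lemma bipartite_knight: "bipartite_fw (knight_framework n :: 'n::finite framework)"
  unfolding bipartite_fw_def
proof (intro exI[of _ "{x. even (\<Sum>k\<in>UNIV. \<lfloor>x $ k\<rfloor>)}"] ballI, clarify)
  fix x y :: "real^'n"
  assume "(x, y) \<in> bars (knight_framework n)"
  then obtain p q i j where pq: "x = grid_point p" "y = grid_point q" and ij: "i \<noteq> j"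
    "\<bar>x $ i - y $ i\<bar> = 1" "\<bar>x $ j - y $ j\<bar> = 2" "\<And>k. k \<noteq> i \<Longrightarrow> k \<noteq> j \<Longrightarrow> x $ k = y $ k"
    by (auto simp: bars_knight joints_knight)
  have "(\<Sum>k\<in>UNIV. \<lfloor>x $ k\<rfloor>) - (\<Sum>k\<in>UNIV. \<lfloor>y $ k\<rfloor>) = (\<lfloor>x $ i\<rfloor> - \<lfloor>y $ i\<rfloor>) + (\<lfloor>x $ j\<rfloor> - \<lfloor>y $ j\<rfloor>)"
    using sum_two_terms[of i j "\<lambda>k. \<lfloor>x $ k\<rfloor> - \<lfloor>y $ k\<rfloor>"] ij by (simp add: sum_subtractf)
  moreover have "\<bar>int (p i) - int (q i)\<bar> = 1" "\<bar>int (p j) - int (q j)\<bar> = 2"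
    using ij(2,3) unfolding pq grid_point_nth by linarith+
  ultimately have "odd ((\<Sum>k\<in>UNIV. \<lfloor>x $ k\<rfloor>) - (\<Sum>k\<in>UNIV. \<lfloor>y $ k\<rfloor>))"
    unfolding pq grid_point_nth floor_of_nat by presburger
  then show "x \<in> {x. even (\<Sum>k\<in>UNIV. \<lfloor>x $ k\<rfloor>)} \<longleftrightarrow> y \<notin> {x. even (\<Sum>k\<in>UNIV. \<lfloor>x $ k\<rfloor>)}"
    by auto
qed

section \<open>Infinitesimal rigidity\<close>

text \<open>With the other coordinates fixed, planar knight moves are bars of the framework, and
  only components \<open>i\<close> and \<open>j\<close> enter the inner product.\<close>

lemma knight_motion_slice:
  fixes g :: "real^'n::finite \<Rightarrow> real^'n"
  assumes g: "inf_motion_fw (knight_framework 5) g" and ij: "i \<noteq> j" and p: "\<And>k. p k < 5"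
  shows "knight_motion (\<lambda>a b. g (grid_point (p(i := a, j := b))) $ i)
    (\<lambda>a b. g (grid_point (p(i := a, j := b))) $ j)"
proof
  fix a b c d :: nat
  assume less: "a < 5" "b < 5" "c < 5" "d < 5"
    and adj: "\<bar>real a - real c\<bar> = 1 \<and> \<bar>real b - real d\<bar> = 2 \<or>
      \<bar>real a - real c\<bar> = 2 \<and> \<bar>real b - real d\<bar> = 1"
  let ?x = "grid_point (p(i := a, j := b))" and ?y = "grid_point (p(i := c, j := d))"
  have "\<exists>k l. k \<noteq> l \<and> \<bar>?x $ k - ?y $ k\<bar> = 1 \<and> \<bar>?x $ l - ?y $ l\<bar> = 2 \<and>
      (\<forall>m. m \<noteq> k \<and> m \<noteq> l \<longrightarrow> ?x $ m = ?y $ m)"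
    using adj
  proof
    assume "\<bar>real a - real c\<bar> = 1 \<and> \<bar>real b - real d\<bar> = 2"
    then show ?thesis using ij by (intro exI[of _ i] exI[of _ j]) auto
  next
    assume "\<bar>real a - real c\<bar> = 2 \<and> \<bar>real b - real d\<bar> = 1"
    then show ?thesis using ij by (intro exI[of _ j] exI[of _ i]) auto
  qed
  then have "(?x, ?y) \<in> bars (knight_framework 5)"
    using less p by (auto simp: bars_knight joints_knight)
  then have "(g ?x - g ?y) \<bullet> (?x - ?y) = 0"
    using g by (auto simp: inf_motion_fw_def)
  then show "(g ?x $ i - g ?y $ i) * (real a - real c) + (g ?x $ j - g ?y $ j) * (real b - real d) = 0"
    using sum_two_terms[of i j "\<lambda>k. (g ?x $ k - g ?y $ k) * (?x $ k - ?y $ k)"] ij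
    by (simp add: inner_vec_def)
qed

text \<open>The quadratic form \<open>Q\<close> of an antisymmetric matrix equals its own negative
  after exchanging the summation indices.\<close>

lemma inf_motion_space_antisym:
  fixes s :: "'n::finite \<Rightarrow> 'n \<Rightarrow> real"
  assumes s: "\<And>i j. s i j = - s j i"
  shows "inf_motion_space (\<lambda>x :: real^'n. \<chi> i. t i + (\<Sum>j\<in>UNIV. s i j * x $ j))"
  unfolding inf_motion_space_def
proof (intro allI)
  fix x y :: "real^'n"
  let ?z = "x - y"
  define Q where "Q = (\<Sum>i\<in>UNIV. \<Sum>j\<in>UNIV. s i j * ?z $ j * ?z $ i)"
  have "Q = (\<Sum>i\<in>UNIV. \<Sum>j\<in>UNIV. s j i * ?z $ i * ?z $ j)"
    unfolding Q_def by (rule sum.swap)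
  also have "\<dots> = (\<Sum>i\<in>UNIV. \<Sum>j\<in>UNIV. - (s i j * ?z $ j * ?z $ i))"
    by (intro sum.cong refl) (subst s, simp)
  also have "\<dots> = - Q"
    by (simp add: Q_def sum_negf)
  finally have "Q = 0" by simp
  moreover have "((\<chi> i. t i + (\<Sum>j\<in>UNIV. s i j * x $ j)) -
      (\<chi> i. t i + (\<Sum>j\<in>UNIV. s i j * y $ j))) \<bullet> ?z = Q"
    by (simp add: Q_def inner_vec_def sum_distrib_right right_diff_distrib left_diff_distrib
        flip: sum_subtractf)
  ultimately show "((\<chi> i. t i + (\<Sum>j\<in>UNIV. s i j * x $ j)) -
      (\<chi> i. t i + (\<Sum>j\<in>UNIV. s i j * y $ j))) \<bullet> ?z = 0"
    by simp
qed

lemma inf_rigid_knight: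
  assumes "CARD('n::finite) \<ge> 2"
  shows "inf_rigid (knight_framework 5 :: 'n framework)"
  unfolding inf_rigid_def
proof (intro allI impI)
  fix g :: "real^'n \<Rightarrow> real^'n"
  assume g: "inf_motion_fw (knight_framework 5) g"
  define h where "h i p = g (grid_point p) $ i" for i p
  interpret slicewise_rigid h 5
  proof
    fix i j :: 'n and p :: "'n \<Rightarrow> nat"
    assume "i \<noteq> j" "\<And>k. p k < 5"
    then interpret knight_motion "\<lambda>a b. h i (p(i := a, j := b))" "\<lambda>a b. h j (p(i := a, j := b))"
      unfolding h_def by (rule knight_motion_slice[OF g])
    show "\<exists>w. \<forall>a<5. \<forall>b<5.
      h i (p(i := a, j := b)) = h i (p(i := 0, j := 0)) - w * real b \<and>
      h j (p(i := a, j := b)) = h j (p(i := 0, j := 0)) + w * real a"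
      using rigid_motion by blast
  next
    fix i :: 'n
    show "\<exists>j. j \<noteq> i"
    proof (rule ccontr)
      assume "\<nexists>j. j \<noteq> i"
      then have "UNIV = {i}" by auto
      then have "CARD('n) = 1" by (metis card.empty card.insert empty_iff finite.emptyI One_nat_def)
      with assms show False by simp
    qed
  qed simp
  \<comment> \<open>The affine formula valid on the grid, read at arbitrary real points.\<close>
  let ?f = "\<lambda>x :: real^'n. \<chi> i. h i (\<lambda>_. 0) + (\<Sum>j\<in>UNIV. slope i j (\<lambda>_. 0) * x $ j)"
  have "inf_motion_space ?f"
    by (rule inf_motion_space_antisym) (rule slope_antisym, simp)
  moreover have "g x = ?f x" if "x \<in> joints (knight_framework 5)" for x
  proof -
    from that obtain p where "x = grid_point p" "\<And>k. p k < 5"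
      by (auto simp: joints_knight)
    then have "g x $ i = ?f x $ i" for i
      using globally_affine[of p i] by (simp flip: h_def)
    then show ?thesis
      by (simp add: vec_eq_iff)
  qed
  ultimately show "\<exists>f. inf_motion_space f \<and> (\<forall>x\<in>joints (knight_framework 5). g x = f x)"
    by blast
qed

theorem theorem9:
  assumes "CARD('n::finite) \<ge> 2"
  shows "is_framework (knight_framework 5 :: 'n framework) \<and>
         unit_bar (knight_framework 5 :: 'n framework) \<and>
         bipartite_fw (knight_framework 5 :: 'n framework) \<and>
         inf_rigid (knight_framework 5 :: 'n framework)"
  using is_framework_knight unit_bar_knight bipartite_knight inf_rigid_knight[OF assms] by blast

end
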